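(* Let $\mathcal{A}=\{A_1,\dots,A_m\}$ be a finite family of real $d\times d$ matrices with probabilities $p_1,\dots,p_m$. Then for every $k\in\mathbb{N}$ $$\Gamma_k(I)\ \le\ \frac1k\,\mathbf{E}\bigl\{\log\|B\|_2\ \big|\ B\in\mathcal{A}^k\bigr\}.$$
   Context: $p_j>0$, $\sum_{j=1}^m p_j=1$. For $k\ge1$, $\mathcal{A}^k$ is the family of all $m^k$ products of length $k$ with the product probabilities, and $\mathbf{E}\{g(B)\mid B\in\mathcal{A}^k\}=\sum_{d_1,\dots,d_k}p_{d_1}\cdots p_{d_k}\,g(A_{d_k}\cdots A_{d_1})$, with $\log0=-\infty$. $\|\cdot\|_2$ is the operator norm induced by the Euclidean norm, and $$\Gamma_k(I)=\frac1{2k}\ \sup_{X\succeq0,\ \mathrm{tr}(X)=1}\ \mathbf{E}\bigl\{\log\mathrm{tr}(BXB^* )\ \big|\ B\in\mathcal{A}^k\bigr\},$$ where the supremum is over real symmetric positive semidefinite $d\times d$ matrices $X$ with trace $1$, and $B^*$ is the transpose of $B$. *)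

theory Defs
  imports "HOL-Analysis.Analysis"
begin

text \<open>Only nonnegative arguments matter; the library value \<open>ln 0 = 0\<close> is replaced by \<open>-\<infinity>\<close>.\<close>

definition elog :: "real \<Rightarrow> ereal" where
  "elog x = (if x \<le> 0 then -\<infinity> else ereal (ln x))"

text \<open>\<open>word_prod A d k\<close> is the product \<open>A (d k) ** \<dots> ** A (d 1)\<close>, later factors on the left.\<close>

primrec word_prod ::
  "(nat \<Rightarrow> real^'n^'n) \<Rightarrow> (nat \<Rightarrow> nat) \<Rightarrow> nat \<Rightarrow> real^'n^'n" where
  "word_prod A d 0 = mat 1"
| "word_prod A d (Suc k) = A (d (Suc k)) ** word_prod A d k"

text \<open>The family is \<open>A 1, \<dots>, A m\<close> with probabilities \<open>p 1, \<dots>, p m\<close>; the sum runs over all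
  \<open>m ^ k\<close> index words, so coinciding products are counted separately. For integrands
  that never take the value \<open>\<infinity>\<close>, such as logarithms, no sum mixes \<open>\<infinity>\<close> and \<open>-\<infinity>\<close>.\<close>

definition expect_prod ::
  "nat \<Rightarrow> (nat \<Rightarrow> real) \<Rightarrow> (nat \<Rightarrow> real^'n^'n) \<Rightarrow> nat \<Rightarrow> (real^'n^'n \<Rightarrow> ereal) \<Rightarrow> ereal" where
  "expect_prod m p A k g =
     (\<Sum>d \<in> {1..k} \<rightarrow>\<^sub>E {1..m}. ereal (\<Prod>i\<in>{1..k}. p (d i)) * g (word_prod A d k))"

definition psd :: "real^'n^'n \<Rightarrow> bool" where
  "psd X \<longleftrightarrow> transpose X = X \<and> (\<forall>v. 0 \<le> v \<bullet> (X *v v))"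

definition Gamma_I ::
  "nat \<Rightarrow> (nat \<Rightarrow> real) \<Rightarrow> (nat \<Rightarrow> real^'n^'n) \<Rightarrow> nat \<Rightarrow> ereal" where
  "Gamma_I m p A k = ereal (1 / (2 * real k)) *
     (SUP X \<in> {X. psd X \<and> trace X = 1}.
        expect_prod m p A k (\<lambda>B. elog (trace (B ** X ** transpose B))))"

end

theory Submission
  imports Defs
begin

text \<open>The point is that \<open>tr (B X B\<^sup>T) \<le> \<parallel>B\<parallel>\<^sup>2 tr X\<close> for positive semidefinite \<open>X\<close>. For \<open>X = v v\<^sup>T\<close>
  this is the definition of the operator norm; the general case reduces to it by splitting off
  rank-one Schur complements, one index at a time, which avoids the spectral theorem.\<close>

definition congr_trace :: "real^'n^'m \<Rightarrow> real^'n^'n \<Rightarrow> real" where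
  "congr_trace B X = trace (B ** X ** transpose B)"

definition outer :: "real^'n \<Rightarrow> real^'n^'n" where
  "outer w = (\<chi> i j. w $ i * w $ j)"

lemma outer_mult_vec: "outer w *v v = (w \<bullet> v) *\<^sub>R w"
  by (simp add: outer_def matrix_vector_mult_def vec_eq_iff inner_vec_def sum_distrib_left
      mult_ac)

lemma trace_outer: "trace (outer w) = (norm w)\<^sup>2"
  by (simp add: trace_def outer_def power2_norm_eq_inner inner_vec_def)

text \<open>Each diagonal entry of \<open>B ** X ** transpose B\<close> is the quadratic form of
  \<open>X\<close> at a row of \<open>B\<close>. In this form linearity in \<open>X\<close> and the
  rank-one case are immediate.\<close>

lemma congr_trace_eq_sum: "congr_trace B X = (\<Sum>i\<in>UNIV. row i B \<bullet> (X *v row i B))"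
  unfolding congr_trace_def trace_def
  by (simp add: matrix_mul_assoc[symmetric])
     (simp add: matrix_matrix_mult_def matrix_vector_mult_def inner_vec_def row_def transpose_def)

lemma congr_trace_outer: "congr_trace B (outer w) = (norm (B *v w))\<^sup>2"
proof -
  have "row i B \<bullet> w = (B *v w) $ i" for i
    by (simp add: row_def inner_vec_def matrix_vector_mult_def)
  then show ?thesis
    by (simp add: congr_trace_eq_sum outer_mult_vec power2_norm_eq_inner inner_vec_def[of "B *v w"]
        inner_commute[of w])
qed

lemma congr_trace_diff_scaleR:
  "congr_trace B (X - s *\<^sub>R Y) = congr_trace B X - s * congr_trace B Y"
  by (simp add: congr_trace_eq_sum matrix_vector_mult_diff_rdistrib scaleR_matrix_vector_assoc[symmetric]
      inner_diff_right sum_subtractf sum_distrib_left)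

lemma trace_diff_scaleR:
  fixes X Y :: "real^'n^'n"
  shows "trace (X - s *\<^sub>R Y) = trace X - s * trace Y"
  by (simp add: trace_def sum_subtractf sum_distrib_left)

lemma psd_inner_commute:
  assumes "psd X"
  shows "v \<bullet> (X *v w) = (X *v v) \<bullet> w"
  using assms dot_lmul_matrix[of v X w] transpose_matrix_vector[of X v] by (simp add: psd_def)

lemma axis_inner_mult_vec:
  fixes X :: "real^'n^'n"
  shows "axis a 1 \<bullet> (X *v v) = (X *v v) $ a"
  by (simp add: inner_axis')

lemma mult_vec_axis_nth:
  fixes X :: "real^'n^'n"
  shows "(X *v axis a 1) $ b = X $ b $ a"
  by (simp add: matrix_vector_mult_basis column_def)

text \<open>Expands the quadratic form at \<open>v - t *\<^sub>R axis a 1\<close>. Suitable choices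
  of \<open>v\<close> and \<open>t\<close> yield all the facts about semidefinite matrices needed
  below.\<close>

lemma psd_shift_quadratic:
  assumes "psd X"
  shows "0 \<le> v \<bullet> (X *v v) - 2 * t * (X *v v) $ a + t\<^sup>2 * X $ a $ a"
proof -
  have "0 \<le> (v - t *\<^sub>R axis a 1) \<bullet> (X *v (v - t *\<^sub>R axis a 1))"
    using assms by (simp add: psd_def)
  also have "\<dots> = v \<bullet> (X *v v) - 2 * t * (X *v v) $ a + t\<^sup>2 * X $ a $ a"
    using psd_inner_commute[OF assms, of v "axis a 1"]
    by (simp add: axis_inner_mult_vec mult_vec_axis_nth power2_eq_square algebra_simps
        inner_commute[of "X *v v"])
  finally show ?thesis .
qed

lemma psd_diagonal_nonneg:
  assumes "psd X"
  shows "0 \<le> X $ a $ a"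
  using psd_shift_quadratic[OF assms, of 0 1 a] by simp

lemma psd_zero_diagonal:
  assumes "psd X" "X $ a $ a = 0"
  shows "X $ a $ b = 0"
proof (rule ccontr)
  assume nz: "X $ a $ b \<noteq> 0"
  \<comment> \<open>With a zero diagonal entry the shifted form is affine in \<open>t\<close>; this
    \<open>t\<close> gives it the value -1.\<close>
  define t where "t = (X $ b $ b + 1) / (2 * X $ a $ b)"
  have "0 \<le> X $ b $ b - 2 * t * X $ a $ b"
    using psd_shift_quadratic[OF assms(1), of "axis b 1" t a] assms(2)
    by (simp add: axis_inner_mult_vec mult_vec_axis_nth)
  then show False
    using nz by (simp add: t_def)
qed

lemma psd_nth_commute:
  assumes "psd X"
  shows "X $ i $ j = X $ j $ i"
  using assms by (simp add: psd_def transpose_def vec_eq_iff)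

text \<open>For symmetric \<open>X\<close> with \<open>X $ a $ a\<close> nonzero, this is the Schur
  complement of that entry, kept at full size with row and column \<open>a\<close> zero, so that the
  type does not change.\<close>

definition schur_step :: "'n \<Rightarrow> real^'n^'n \<Rightarrow> real^'n^'n" where
  "schur_step a X = X - (1 / X $ a $ a) *\<^sub>R outer (X $ a)"

lemma schur_step_nth: "schur_step a X $ i $ j = X $ i $ j - X $ a $ i * X $ a $ j / X $ a $ a"
  by (simp add: schur_step_def outer_def)

lemma psd_schur_step:
  assumes "psd X" "X $ a $ a \<noteq> 0"
  shows "psd (schur_step a X)"
proof -
  have "0 \<le> v \<bullet> (schur_step a X *v v)" for v
  proof -
    have w: "X $ a \<bullet> v = (X *v v) $ a"
      by (simp add: matrix_vector_mul_component)
    show ?thesis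
      \<comment> \<open>This \<open>t\<close> minimises the shifted form; the minimum is the
        quadratic form of the Schur complement at \<open>v\<close>.\<close>
      using psd_shift_quadratic[OF assms(1), of v "(X *v v) $ a / X $ a $ a" a] assms(2)
      by (simp add: schur_step_def matrix_vector_mult_diff_rdistrib scaleR_matrix_vector_assoc[symmetric]
          outer_mult_vec inner_diff_right w inner_commute[of v "X $ a"] power2_eq_square)
  qed
  moreover have "transpose (schur_step a X) = schur_step a X"
    using psd_nth_commute[OF assms(1)]
    by (simp add: transpose_def vec_eq_iff schur_step_nth mult_ac)
  ultimately show ?thesis
    by (simp add: psd_def)
qed

lemma norm_mult_vec_le_onorm:
  fixes B :: "real^'n^'m"
  shows "norm (B *v w) \<le> onorm ((*v) B) * norm w"
  by (simp add: onorm)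

text \<open>Induction on a set \<open>S\<close> of indices outside which the rows of
  \<open>X\<close> vanish. A Schur step clears row \<open>a\<close>, and the rank-one term it
  removes satisfies the bound by the definition of the operator norm.\<close>

lemma psd_congr_trace_le_supported:
  assumes "finite S" "psd X" "\<And>i j. i \<notin> S \<Longrightarrow> X $ i $ j = 0"
  shows "congr_trace B X \<le> (onorm ((*v) B))\<^sup>2 * trace X"
  using assms
proof (induction S arbitrary: X rule: finite_induct)
  case empty
  then have "X = 0"
    by (simp add: vec_eq_iff)
  then show ?case
    by (simp add: congr_trace_eq_sum trace_def)
next
  case (insert a S)
  show ?case
  proof (cases "X $ a $ a = 0")
    case True
    \<comment> \<open>A zero diagonal entry forces the whole row \<open>a\<close> to vanish, so
      \<open>X\<close> is already supported on \<open>S\<close>.\<close>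
    have "X $ i $ j = 0" if "i \<notin> S" for i j
      using that insert.prems(2) psd_zero_diagonal[OF insert.prems(1) True] by (cases "i = a") auto
    with insert.prems(1) show ?thesis
      by (rule insert.IH)
  next
    case False
    let ?s = "1 / X $ a $ a" and ?c = "(onorm ((*v) B))\<^sup>2"
    have "schur_step a X $ i $ j = 0" if "i \<notin> S" for i j
    proof (cases "i = a")
      case True
      then show ?thesis
        using False by (simp add: schur_step_nth)
    next
      case False
      \<comment> \<open>Row \<open>i\<close> of \<open>X\<close> is zero, and by symmetry so is
        \<open>X $ a $ i\<close>; hence the correction term vanishes too.\<close>
      then show ?thesis
        using insert.prems that psd_nth_commute[of X a i] by (simp add: schur_step_nth)
    qed
    with psd_schur_step[OF insert.prems(1) False]
    have "congr_trace B (schur_step a X) \<le> ?c * trace (schur_step a X)"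
      by (rule insert.IH)
    then have "congr_trace B X - ?s * (norm (B *v X $ a))\<^sup>2
        \<le> ?c * (trace X - ?s * (norm (X $ a))\<^sup>2)"
      by (simp only: schur_step_def congr_trace_diff_scaleR trace_diff_scaleR congr_trace_outer
          trace_outer)
    \<comment> \<open>The bound for the removed term; adding it to the induction hypothesis restores
      \<open>X\<close> on both sides.\<close>
    moreover have "?s * (norm (B *v X $ a))\<^sup>2 \<le> ?s * (?c * (norm (X $ a))\<^sup>2)"
    proof (rule mult_left_mono)
      show "(norm (B *v X $ a))\<^sup>2 \<le> ?c * (norm (X $ a))\<^sup>2"
        using power_mono[OF norm_mult_vec_le_onorm[of B "X $ a"], of 2]
        by (simp add: power_mult_distrib)
      show "0 \<le> ?s"
        using psd_diagonal_nonneg insert.prems(1) by simp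
    qed
    ultimately show ?thesis
      by (simp add: algebra_simps)
  qed
qed

lemma psd_trace_congruence_le:
  fixes B :: "real^'n^'m"
  assumes "psd X"
  shows "trace (B ** X ** transpose B) \<le> (onorm ((*v) B))\<^sup>2 * trace X"
  using psd_congr_trace_le_supported[of UNIV X B] assms by (simp add: congr_trace_def)

lemma elog_le_twice_elog:
  assumes "x \<le> y\<^sup>2" "0 \<le> y"
  shows "elog x \<le> ereal 2 * elog y"
proof (cases "x \<le> 0")
  case True
  then show ?thesis
    by (simp add: elog_def)
next
  case False
  with assms have "y > 0"
    by (cases "y = 0") auto
  then have "ln (y\<^sup>2) = 2 * ln y"
    by (simp add: ln_realpow)
  moreover have "ln x \<le> ln (y\<^sup>2)"
    using False assms \<open>y > 0\<close> by simp
  ultimately show ?thesis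
    using False \<open>y > 0\<close> by (simp add: elog_def)
qed

text \<open>A finite nonnegative factor distributes over sums in \<open>ereal\<close> even when
  infinite values occur, so \<open>g\<close> needs no restriction.\<close>

lemma expect_prod_cmult:
  assumes "0 \<le> c"
  shows "expect_prod m p A k (\<lambda>B. ereal c * g B) = ereal c * expect_prod m p A k g"
  by (simp add: expect_prod_def mult.commute[of "ereal c"] sum_distrib_right_ereal[OF assms]
      mult.assoc)

lemma expect_prod_mono:
  assumes "\<And>j. j \<in> {1..m} \<Longrightarrow> 0 \<le> p j" "\<And>B. f B \<le> g B"
  shows "expect_prod m p A k f \<le> expect_prod m p A k g"
  unfolding expect_prod_def
proof (intro sum_mono ereal_mult_left_mono assms(2))
  fix d
  assume "d \<in> {1..k} \<rightarrow>\<^sub>E {1..m}"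
  then have "0 \<le> (\<Prod>i\<in>{1..k}. p (d i))"
    by (intro prod_nonneg assms(1)) (rule PiE_mem)
  then show "0 \<le> ereal (\<Prod>i\<in>{1..k}. p (d i))"
    by simp
qed

theorem proposition2:
  fixes A :: "nat \<Rightarrow> real^'n^'n" and p :: "nat \<Rightarrow> real" and m k :: nat
  assumes p_pos: "\<And>j. j \<in> {1..m} \<Longrightarrow> p j > 0"
    and p_sum: "(\<Sum>j = 1..m. p j) = 1"
    and k: "k \<ge> 1"
  shows "Gamma_I m p A k
    \<le> ereal (1 / real k) * expect_prod m p A k (\<lambda>B. elog (onorm (\<lambda>v. B *v v)))"
proof -
  let ?E = "expect_prod m p A k"
  have "?E (\<lambda>B. elog (trace (B ** X ** transpose B))) \<le> ereal 2 * ?E (\<lambda>B. elog (onorm ((*v) B)))"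
    if X: "psd X" "trace X = 1" for X
  proof -
    \<comment> \<open>Since \<open>trace X = 1\<close>, the trace is at most the squared operator
      norm, whatever \<open>X\<close> is.\<close>
    have "elog (trace (B ** X ** transpose B)) \<le> ereal 2 * elog (onorm ((*v) B))"
      for B :: "real^'n^'n"
      using psd_trace_congruence_le[OF X(1), of B] X(2)
      by (intro elog_le_twice_elog) (simp_all add: onorm_pos_le)
    then have "?E (\<lambda>B. elog (trace (B ** X ** transpose B)))
        \<le> ?E (\<lambda>B. ereal 2 * elog (onorm ((*v) B)))"
      using p_pos by (intro expect_prod_mono) (auto simp: less_imp_le)
    then show ?thesis
      by (simp only: expect_prod_cmult zero_le_numeral)
  qed
  \<comment> \<open>The bound is independent of \<open>X\<close>, so it passes to the supremum; the
    factor 2 then cancels.\<close>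
  then have "Gamma_I m p A k \<le> ereal (1 / (2 * real k)) * (ereal 2 * ?E (\<lambda>B. elog (onorm ((*v) B))))"
    unfolding Gamma_I_def by (intro ereal_mult_left_mono SUP_least) auto
  also have "\<dots> = ereal (1 / real k) * ?E (\<lambda>B. elog (onorm ((*v) B)))"
    by (simp add: mult.assoc[symmetric])
  finally show ?thesis .
qed

end
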